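(* Consider the state-dependent coefficient system $\dot\xi(t)=A(\xi(t))\,\xi(t)$ with $A\colon\mathbb R^n\to\mathbb R^{n\times n}$ Lipschitz continuous. Let $X\subset\mathbb R^n$ be a bounded set such that every solution $\xi$ of the system with $\xi(0)\in X$ satisfies $\xi(t)\in X$ for all $t\ge 0$ for which it is defined. Let $L\in\mathbb R$, $K>0$, $\omega>0$ be constants such that $$\|A(x_1)-A(x_2)\|\le L\|x_1-x_2\|\quad\text{for all }x_1,x_2\in X,$$ $$\|e^{A(x)s}\|\le K e^{-\omega s}\quad\text{for all }x\in X\text{ and all } s>0.$$ Put $M:=\sup_{x\in X}\|A(x)x\|$. Then for any $x_0\in X$, the unique solution $\xi\colon[0,\infty)\to\mathbb R^n$ of $\dot\xi(t)=A(\xi(t))\xi(t)$ with $\xi(0)=x_0$ satisfies $$\|\xi(t)\|\le K\,e^{t\,(\sqrt{KLM\log 2}-\omega)}\,\|x_0\|\quad\text{for all } t>0.$$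
   Context: $\|\cdot\|$ denotes a fixed norm on $\mathbb R^n$ and the induced operator norm on $\mathbb R^{n\times n}$; $\log$ is the natural logarithm. *)

theory Defs
  imports "HOL-Analysis.Analysis"
begin

text \<open>
  The norm on \<open>real ^ 'n\<close> is an arbitrary one, so it cannot be the type-class norm, which is
  Euclidean. Only topological notions (boundedness, derivatives, convergence of series), which do
  not depend on the norm in finite dimension, are taken from the type classes.
\<close>

definition is_norm :: "(real ^ 'n \<Rightarrow> real) \<Rightarrow> bool" where
  "is_norm N \<longleftrightarrow>
     (\<forall>x. 0 \<le> N x) \<and>
     (\<forall>x. N x = 0 \<longleftrightarrow> x = 0) \<and>
     (\<forall>c x. N (c *\<^sub>R x) = \<bar>c\<bar> * N x) \<and>
     (\<forall>x y. N (x + y) \<le> N x + N y)"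

definition op_norm :: "(real ^ 'n \<Rightarrow> real) \<Rightarrow> real ^ 'n ^ 'n \<Rightarrow> real" where
  "op_norm N B = (SUP x\<in>{x. x \<noteq> 0}. N (B *v x) / N x)"

text \<open>
  The type \<open>real ^ 'n ^ 'n\<close> is not an instance of \<open>real_normed_algebra_1\<close> with matrix
  multiplication, so \<open>exp\<close> and \<open>power\<close> from the library do not apply to it.
\<close>

primrec mat_power :: "real ^ 'n ^ 'n \<Rightarrow> nat \<Rightarrow> real ^ 'n ^ 'n" where
  "mat_power B 0 = mat 1"
| "mat_power B (Suc k) = B ** mat_power B k"

definition mat_exp :: "real ^ 'n ^ 'n \<Rightarrow> real ^ 'n ^ 'n" where
  "mat_exp B = (\<Sum>k. (1 / fact k) *\<^sub>R mat_power B k)"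

text \<open>
  \<open>J\<close> is meant to be an interval containing \<open>0\<close>; at an end point of \<open>J\<close> that belongs to
  \<open>J\<close> the derivative is one-sided.
\<close>

definition sdc_solution ::
    "(real ^ 'n \<Rightarrow> real ^ 'n ^ 'n) \<Rightarrow> real set \<Rightarrow> (real \<Rightarrow> real ^ 'n) \<Rightarrow> bool" where
  "sdc_solution A J \<xi> \<longleftrightarrow>
     (\<forall>t\<in>J. (\<xi> has_vector_derivative A (\<xi> t) *v \<xi> t) (at t within J))"

definition forward_invariant ::
    "(real ^ 'n \<Rightarrow> real ^ 'n ^ 'n) \<Rightarrow> (real ^ 'n) set \<Rightarrow> bool" where
  "forward_invariant A X \<longleftrightarrow>
     (\<forall>J \<xi>. is_interval J \<and> 0 \<in> J \<and> sdc_solution A J \<xi> \<and> \<xi> 0 \<in> X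
        \<longrightarrow> (\<forall>t\<in>J. 0 \<le> t \<longrightarrow> \<xi> t \<in> X))"

end

theory Submission
  imports Defs
begin

text \<open>
  Freeze the coefficient matrix at \<open>B = A (\<xi> r)\<close> for one \<open>r \<le> t\<close>. Variation of constants and
  \<open>N (\<xi> s - \<xi> r) \<le> M * \<bar>s - r\<bar>\<close> give, for \<open>u s = exp (\<omega> * s) * N (\<xi> s)\<close>, the inequality
  \<open>u t \<le> K * u 0 + K * L * M * \<integral> \<bar>s - r\<bar> * u s ds\<close> over \<open>[0, t]\<close>. Its kernel is compared with
  \<open>u s = exp (\<mu> * s)\<close>: the best \<open>r\<close> lies \<open>ln 2 / \<mu>\<close> before \<open>t\<close>, and the exponential is then a
  supersolution as soon as \<open>K * L * M * ln 2 \<le> \<mu>\<^sup>2\<close>. Integrals of vectors are avoided by a mean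
  value inequality for \<open>N\<close>, proved by testing with a subgradient of \<open>N\<close>.
\<close>

subsection \<open>Arbitrary norms on Euclidean space\<close>

lemma is_normD:
  assumes "is_norm N"
  shows "0 \<le> N x" "N x = 0 \<longleftrightarrow> x = 0" "N (c *\<^sub>R x) = \<bar>c\<bar> * N x" "N (x + y) \<le> N x + N y"
    "N (- x) = N x" "N (x - y) = N (y - x)"
proof -
  show 1: "0 \<le> N x" "N x = 0 \<longleftrightarrow> x = 0" "N (c *\<^sub>R x) = \<bar>c\<bar> * N x" "N (x + y) \<le> N x + N y" for c x y
    using assms by (auto simp: is_norm_def)
  show 2: "N (- x) = N x" for x
    using 1(3)[of "-1" x] by simp
  show "N (x - y) = N (y - x)"
    using 2[of "x - y"] by simp
qed

lemma is_norm_sum_le: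
  assumes "is_norm N"
  shows "N (sum f S) \<le> (\<Sum>i\<in>S. N (f i))"
proof (cases "finite S")
  case True
  then show ?thesis
  proof induction
    case empty
    show ?case using is_normD(2)[OF assms, of 0] by simp
  next
    case (insert i S)
    then show ?case using is_normD(4)[OF assms, of "f i" "sum f S"] by simp
  qed
next
  case False
  then show ?thesis using is_normD(2)[OF assms, of 0] by simp
qed

lemma is_norm_le_norm:
  fixes N :: "real ^ 'n \<Rightarrow> real"
  assumes "is_norm N"
  obtains c where "0 < c" "\<And>x. N x \<le> c * norm x"
proof
  define c where "c = (\<Sum>i\<in>UNIV. N (axis i 1)) + 1"
  show "0 < c"
    using is_normD(1)[OF assms] by (auto simp: c_def intro!: add_nonneg_pos sum_nonneg)
  fix x :: "real ^ 'n"
  have "N x = N (\<Sum>i\<in>UNIV. x $ i *\<^sub>R axis i 1)"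
    by (simp add: basis_expansion flip: scalar_mult_eq_scaleR)
  also have "\<dots> \<le> (\<Sum>i\<in>UNIV. \<bar>x $ i\<bar> * N (axis i 1))"
    using is_norm_sum_le[OF assms, of "\<lambda>i. x $ i *\<^sub>R axis i 1" UNIV] is_normD(3)[OF assms] by simp
  also have "\<dots> \<le> (\<Sum>i\<in>UNIV. norm x * N (axis i 1))"
    by (intro sum_mono mult_right_mono component_le_norm_cart is_normD(1)[OF assms])
  also have "\<dots> \<le> c * norm x"
    by (simp add: c_def algebra_simps sum_distrib_left)
  finally show "N x \<le> c * norm x" .
qed

lemma is_norm_continuous_on:
  assumes "is_norm N"
  shows "continuous_on S N"
proof -
  obtain c where c: "0 < c" "\<And>x. N x \<le> c * norm x"
    using is_norm_le_norm[OF assms] by blast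
  have "\<bar>N x - N y\<bar> \<le> c * dist x y" for x y
    using is_normD(4)[OF assms, of "x - y" y] is_normD(4)[OF assms, of "y - x" x]
      is_normD(6)[OF assms, of x y] c(2)[of "x - y"]
    by (simp add: dist_norm)
  then have "c-lipschitz_on UNIV N"
    using c by (intro lipschitz_onI) (auto simp: dist_real_def)
  then show ?thesis
    using lipschitz_on_continuous_on continuous_on_subset by blast
qed

text \<open>By compactness \<open>N\<close> attains a positive minimum on the Euclidean unit sphere;
  homogeneity carries the comparison to all vectors.\<close>

lemma norm_le_is_norm:
  fixes N :: "real ^ 'n \<Rightarrow> real"
  assumes "is_norm N"
  obtains c where "0 < c" "\<And>x. norm x \<le> c * N x"
proof -
  have "compact (sphere (0 :: real ^ 'n) 1)" "sphere (0 :: real ^ 'n) 1 \<noteq> {}"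
    by (auto simp: sphere_eq_empty)
  then obtain u where u: "u \<in> sphere 0 1" "\<And>y. y \<in> sphere 0 1 \<Longrightarrow> N u \<le> N y"
    using continuous_attains_inf[OF _ _ is_norm_continuous_on[OF assms]] by metis
  have Nu: "0 < N u"
    using u(1) is_normD(1,2)[OF assms, of u] by (auto simp: less_le)
  show ?thesis
  proof
    show "0 < 1 / N u" using Nu by simp
    fix x :: "real ^ 'n"
    show "norm x \<le> 1 / N u * N x"
    proof (cases "x = 0")
      case True
      then show ?thesis using is_normD(2)[OF assms, of 0] by simp
    next
      case False
      then have "N u \<le> N ((1 / norm x) *\<^sub>R x)" by (intro u(2)) simp
      also have "\<dots> = N x / norm x" using is_normD(3)[OF assms] by simp
      finally show ?thesis using Nu False by (simp add: field_simps)
    qed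
  qed
qed

section \<open>The operator norm induced by \<open>N\<close>\<close>

lemma op_norm_bdd_above:
  fixes B :: "real ^ 'n ^ 'n"
  assumes "is_norm N"
  shows "bdd_above ((\<lambda>x. N (B *v x) / N x) ` {x. x \<noteq> 0})"
proof -
  obtain c where c: "0 < c" "\<And>x. N x \<le> c * norm x"
    using is_norm_le_norm[OF assms] by blast
  obtain d where d: "0 < d" "\<And>x. norm x \<le> d * N x"
    using norm_le_is_norm[OF assms] by blast
  \<comment> \<open>A real \<open>SUP\<close> is informative only for a set bounded above; comparing
    \<open>N\<close> with the Euclidean norm in both directions supplies the bound.\<close>
  have "N (B *v x) / N x \<le> c * onorm ((*v) B) * d" if "x \<noteq> 0" for x
  proof -
    have "N (B *v x) \<le> c * (onorm ((*v) B) * norm x)"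
      using c onorm[OF matrix_vector_mul_bounded_linear, of B x]
      by (meson mult_left_mono order_trans less_imp_le)
    also have "\<dots> \<le> c * (onorm ((*v) B) * (d * N x))"
      using c d onorm_pos_le[OF matrix_vector_mul_bounded_linear, of B]
      by (intro mult_left_mono) auto
    finally show ?thesis
      using that is_normD(1,2)[OF assms, of x] by (simp add: divide_le_eq mult_ac less_le)
  qed
  then show ?thesis by (intro bdd_aboveI2) auto
qed

lemma op_norm_ge:
  assumes "is_norm N"
  shows "N (B *v x) \<le> op_norm N B * N x"
proof (cases "x = 0")
  case True
  then show ?thesis using is_normD(2)[OF assms, of 0] by simp
next
  case False
  then have "N (B *v x) / N x \<le> op_norm N B"
    unfolding op_norm_def by (intro cSUP_upper op_norm_bdd_above assms) auto
  moreover have "0 < N x"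
    using False is_normD(1,2)[OF assms, of x] by (simp add: less_le)
  ultimately show ?thesis by (simp add: divide_le_eq)
qed

lemma op_norm_nonneg:
  fixes B :: "real ^ 'n ^ 'n"
  assumes "is_norm N"
  shows "0 \<le> op_norm N B"
proof -
  \<comment> \<open>Every index type is inhabited, so a nonzero vector exists and the supremum runs
    over a nonempty set.\<close>
  have ne: "axis undefined 1 \<noteq> (0 :: real ^ 'n)" by (simp add: axis_eq_0_iff)
  have "0 \<le> N (B *v axis undefined 1) / N (axis undefined 1)"
    using is_normD(1)[OF assms] by simp
  also have "\<dots> \<le> op_norm N B"
    unfolding op_norm_def using ne by (intro cSUP_upper op_norm_bdd_above assms) auto
  finally show ?thesis .
qed

text \<open>Hahn-Banach in finite dimension: a hyperplane separates the open unit ball of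
  \<open>N\<close> from the normalised \<open>v\<close>, and its rescaled normal is
  \<open>p\<close>.\<close>

lemma is_norm_subgradient:
  fixes N :: "real ^ 'n \<Rightarrow> real"
  assumes "is_norm N"
  obtains p where "p \<bullet> v = N v" "\<And>x. p \<bullet> x \<le> N x"
proof (cases "v = 0")
  case True
  show ?thesis
    by (rule that[of 0]) (use True is_normD(1)[OF assms] is_normD(2)[OF assms, of 0] in auto)
next
  case False
  let ?S = "{x. N x < 1}"
  have pos: "0 < N x" if "x \<noteq> 0" for x
    using that is_normD(1,2)[OF assms, of x] by (simp add: less_le)
  have "convex ?S"
  proof (rule convexI)
    fix x y :: "real ^ 'n" and a b :: real
    assume *: "x \<in> ?S" "y \<in> ?S" "0 \<le> a" "0 \<le> b" "a + b = 1"
    have "N (a *\<^sub>R x + b *\<^sub>R y) \<le> a * N x + b * N y"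
      using is_normD(4)[OF assms, of "a *\<^sub>R x" "b *\<^sub>R y"] is_normD(3)[OF assms] * by simp
    also have "\<dots> < 1"
      using * by (intro convex_bound_lt) auto
    finally show "a *\<^sub>R x + b *\<^sub>R y \<in> ?S" by simp
  qed
  moreover have "0 \<in> ?S" using is_normD(2)[OF assms, of 0] by simp
  moreover have "v /\<^sub>R N v \<notin> ?S"
    using pos[OF False] is_normD(3)[OF assms] by simp
  ultimately obtain a b where a: "a \<noteq> 0" "\<And>x. N x < 1 \<Longrightarrow> a \<bullet> x \<le> b" "b \<le> a \<bullet> (v /\<^sub>R N v)"
    using separating_hyperplane_sets[of ?S "{v /\<^sub>R N v}"] by force
  have b0: "0 \<le> b" using a(2)[of 0] is_normD(2)[OF assms, of 0] by simp
  have le: "a \<bullet> x \<le> b * N x" for x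
  proof (cases "x = 0")
    case False
    note p = pos[OF this]
    \<comment> \<open>Separation controls only the open ball, so \<open>x\<close> is scaled to
      \<open>N\<close>-length \<open>k < 1\<close>, and then \<open>k\<close> tends to 1.\<close>
    have "k * (a \<bullet> x) \<le> b * N x" if k: "0 < k" "k < 1" for k
    proof -
      have "a \<bullet> ((k / N x) *\<^sub>R x) \<le> b"
        using k p is_normD(3)[OF assms] by (intro a(2)) simp
      then show ?thesis using p by (simp add: divide_le_eq)
    qed
    then show ?thesis by (rule field_le_mult_one_interval)
  qed (use is_normD(2)[OF assms, of 0] in simp)
  \<comment> \<open>If \<open>b\<close> were 0, \<open>le\<close> at \<open>a\<close> itself would
    give \<open>a \<bullet> a \<le> 0\<close>.\<close>
  have "0 < a \<bullet> a" using a(1) by simp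
  with le[of a] have b: "0 < b" using b0 by (cases "b = 0") auto
  have "b * N v \<le> a \<bullet> v" using a(3) pos[OF False] by (simp add: field_simps)
  with le[of v] have eq: "a \<bullet> v = b * N v" by simp
  show ?thesis
    by (rule that[of "a /\<^sub>R b"]) (use b eq le in \<open>auto simp: field_simps\<close>)
qed

text \<open>Pairing with a subgradient at \<open>w b - w a\<close> reduces the claim to monotonicity
  of the real function \<open>\<phi> - p \<bullet> w\<close>.\<close>

lemma is_norm_increment_le:
  fixes N :: "real ^ 'n \<Rightarrow> real"
  assumes N: "is_norm N" and "a \<le> b"
    and w: "continuous_on {a..b} w" "\<And>s. a < s \<Longrightarrow> s < b \<Longrightarrow> (w has_vector_derivative w' s) (at s)"
    and \<phi>: "continuous_on {a..b} \<phi>" "\<And>s. a < s \<Longrightarrow> s < b \<Longrightarrow> (\<phi> has_real_derivative \<phi>' s) (at s)"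
    and le: "\<And>s. a < s \<Longrightarrow> s < b \<Longrightarrow> N (w' s) \<le> \<phi>' s"
  shows "N (w b - w a) \<le> \<phi> b - \<phi> a"
proof -
  obtain p where p: "p \<bullet> (w b - w a) = N (w b - w a)" "\<And>x. p \<bullet> x \<le> N x"
    using is_norm_subgradient[OF N, of "w b - w a"] by blast
  have "\<phi> a - p \<bullet> w a \<le> \<phi> b - p \<bullet> w b"
  proof (rule DERIV_nonneg_imp_increasing_open[OF \<open>a \<le> b\<close>])
    fix s assume s: "a < s" "s < b"
    have "((\<lambda>s. p \<bullet> w s) has_real_derivative p \<bullet> w' s) (at s)"
      unfolding has_real_derivative_iff_has_vector_derivative
      by (rule bounded_linear.has_vector_derivative[OF bounded_linear_inner_right w(2)[OF s]])
    then have "((\<lambda>s. \<phi> s - p \<bullet> w s) has_real_derivative \<phi>' s - p \<bullet> w' s) (at s)"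
      by (intro DERIV_diff \<phi> s)
    moreover have "0 \<le> \<phi>' s - p \<bullet> w' s"
      using p(2)[of "w' s"] le[OF s] by simp
    ultimately show "\<exists>y. ((\<lambda>s. \<phi> s - p \<bullet> w s) has_real_derivative y) (at s) \<and> 0 \<le> y" by blast
  qed (intro continuous_intros w \<phi>)
  with p(1) show ?thesis by (simp add: inner_diff_right)
qed

subsection \<open>The matrix exponential\<close>

lemma mat_power_Suc_right: "mat_power B (Suc k) = mat_power B k ** B"
  by (induction k) (simp_all add: matrix_mul_assoc)

lemma mat_power_scaleR: "mat_power (s *\<^sub>R B) k = s ^ k *\<^sub>R mat_power B k"
  by (induction k)
    (simp_all add: matrix_matrix_mult_def vec_eq_iff sum_distrib_left mult_ac)

text \<open>The entry is component \<open>i\<close> of \<open>mat_power B k\<close> applied to the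
  unit vector \<open>axis j 1\<close>.\<close>

lemma abs_mat_power_entry_le: "\<bar>mat_power B k $ i $ j\<bar> \<le> onorm ((*v) B) ^ k"
proof -
  have "norm (mat_power B k *v v) \<le> onorm ((*v) B) ^ k * norm v" for v
  proof (induction k)
    case (Suc k)
    have "norm (mat_power B (Suc k) *v v) \<le> onorm ((*v) B) * norm (mat_power B k *v v)"
      by (metis mat_power.simps(2) matrix_vector_mul_assoc matrix_vector_mul_bounded_linear onorm)
    also have "\<dots> \<le> onorm ((*v) B) * (onorm ((*v) B) ^ k * norm v)"
      by (intro mult_left_mono Suc onorm_pos_le matrix_vector_mul_bounded_linear)
    finally show ?case by simp
  qed simp
  from this[of "axis j 1"] component_le_norm_cart[of "mat_power B k *v axis j 1" i]
  show ?thesis by (simp add: matrix_vector_mul_component inner_axis)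
qed

lemma summable_mat_exp_entry: "summable (\<lambda>k. mat_power B k $ i $ j / fact k * s ^ k)"
proof (rule summable_comparison_test)
  have "norm (mat_power B k $ i $ j / fact k * s ^ k) \<le> (onorm ((*v) B) * \<bar>s\<bar>) ^ k /\<^sub>R fact k" for k
    using mult_right_mono[OF abs_mat_power_entry_le[of B k i j], of "\<bar>s\<bar> ^ k / fact k"]
    by (simp add: abs_mult power_abs power_mult_distrib divide_inverse mult_ac)
  then show "\<exists>N. \<forall>n\<ge>N. norm (mat_power B n $ i $ j / fact n * s ^ n) \<le> (onorm ((*v) B) * \<bar>s\<bar>) ^ n /\<^sub>R fact n"
    by blast
  show "summable (\<lambda>n. (onorm ((*v) B) * \<bar>s\<bar>) ^ n /\<^sub>R fact n)"
    by (rule summable_exp_generic)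
qed

text \<open>Convergence of matrices is entrywise, so each entry is a scalar power series in
  \<open>s\<close> that can be differentiated termwise.\<close>

lemma mat_exp_entry: "mat_exp (s *\<^sub>R B) $ i $ j = (\<Sum>k. mat_power B k $ i $ j / fact k * s ^ k)"
proof -
  have "(\<lambda>k. (1 / fact k) *\<^sub>R mat_power (s *\<^sub>R B) k) sums
      (\<chi> i j. \<Sum>k. mat_power B k $ i $ j / fact k * s ^ k)"
    unfolding sums_def
  proof (intro vec_tendstoI)
    fix i j
    have "(\<lambda>k. mat_power B k $ i $ j / fact k * s ^ k) sums (\<Sum>k. mat_power B k $ i $ j / fact k * s ^ k)"
      by (rule summable_sums[OF summable_mat_exp_entry])
    then show "(\<lambda>n. (\<Sum>k<n. (1 / fact k) *\<^sub>R mat_power (s *\<^sub>R B) k) $ i $ j) \<longlonglongrightarrow>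
        (\<chi> i j. \<Sum>k. mat_power B k $ i $ j / fact k * s ^ k) $ i $ j"
      by (simp add: sums_def mat_power_scaleR mult_ac)
  qed
  then show ?thesis by (simp add: mat_exp_def sums_iff)
qed

lemma mat_exp_0: "mat_exp (0 *\<^sub>R B) = mat 1"
  unfolding vec_eq_iff mat_exp_entry
  by (subst powser_zero) simp

text \<open>\<open>f\<close> is the sum of its components embedded by the isometries
  \<open>axis i\<close>. The entry type is general because a matrix is a vector of rows: one use
  reaches the rows, a second the entries.\<close>

lemma has_vector_derivative_vec:
  fixes f :: "real \<Rightarrow> 'a::real_normed_vector ^ 'b"
  assumes "\<And>i. ((\<lambda>s. f s $ i) has_vector_derivative f' $ i) F"
  shows "(f has_vector_derivative f') F"
proof -
  have "norm (axis i x :: 'a ^ 'b) = norm x" for i x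
  proof -
    have "(norm ((axis i x :: 'a ^ 'b) $ j))\<^sup>2 = (if j = i then (norm x)\<^sup>2 else 0)" for j
      by (simp add: axis_def)
    then show ?thesis by (simp add: norm_vec_def L2_set_def)
  qed
  then have "bounded_linear (axis i :: 'a \<Rightarrow> 'a ^ 'b)" for i
    by (intro bounded_linear_intro[where K=1]) (auto simp: axis_def vec_eq_iff)
  then have "((\<lambda>s. \<Sum>i\<in>UNIV. axis i (f s $ i)) has_vector_derivative (\<Sum>i\<in>UNIV. axis i (f' $ i))) F"
    by (intro has_vector_derivative_sum) (rule bounded_linear.has_vector_derivative[OF _ assms])
  moreover have "(\<Sum>i\<in>UNIV. axis i (v $ i)) = v" for v :: "'a ^ 'b"
    by (simp add: vec_eq_iff axis_def sum.delta)
  ultimately show ?thesis by simp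
qed

lemma mat_exp_has_vector_derivative:
  "((\<lambda>s. mat_exp (s *\<^sub>R B)) has_vector_derivative mat_exp (s *\<^sub>R B) ** B) (at s)"
proof (intro has_vector_derivative_vec)
  fix i j
  let ?c = "\<lambda>k. mat_power B k $ i $ j / fact k"
  \<comment> \<open>\<open>diffs\<close> turns \<open>1 / fact (Suc k)\<close> into
    \<open>1 / fact k\<close>; the remaining power sheds one factor \<open>B\<close> on the
    right.\<close>
  have "diffs ?c k * s ^ k = (\<Sum>l\<in>UNIV. mat_power B k $ i $ l / fact k * s ^ k * B $ l $ j)" for k
    unfolding diffs_def mat_power_Suc_right matrix_matrix_mult_def
    by (simp add: sum_divide_distrib sum_distrib_left sum_distrib_right field_simps del: of_nat_Suc)
  then have "(\<Sum>k. diffs ?c k * s ^ k)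
      = (\<Sum>l\<in>UNIV. \<Sum>k. mat_power B k $ i $ l / fact k * s ^ k * B $ l $ j)"
    by (simp only:) (intro suminf_sum summable_mult2 summable_mat_exp_entry)
  also have "\<dots> = (mat_exp (s *\<^sub>R B) ** B) $ i $ j"
    by (simp only: matrix_matrix_mult_def vec_lambda_beta mat_exp_entry
        suminf_mult2[OF summable_mat_exp_entry])
  finally have "(\<Sum>k. diffs ?c k * s ^ k) = (mat_exp (s *\<^sub>R B) ** B) $ i $ j" .
  \<comment> \<open>The series converges everywhere, so any radius beyond
    \<open>\<bar>s\<bar>\<close> serves.\<close>
  moreover have "((\<lambda>s. \<Sum>k. ?c k * s ^ k) has_real_derivative (\<Sum>k. diffs ?c k * s ^ k)) (at s)"
    by (rule termdiffs_strong[where K="\<bar>s\<bar> + 1"]) (rule summable_mat_exp_entry, simp)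
  ultimately show "((\<lambda>s. mat_exp (s *\<^sub>R B) $ i $ j) has_vector_derivative (mat_exp (s *\<^sub>R B) ** B) $ i $ j) (at s)"
    by (simp add: mat_exp_entry has_real_derivative_iff_has_vector_derivative)
qed

lemma bounded_bilinear_matrix_vector_mult:
  "bounded_bilinear ((*v) :: real ^ 'n ^ 'm \<Rightarrow> real ^ 'n \<Rightarrow> real ^ 'm)"
  unfolding bilinear_conv_bounded_bilinear[symmetric] bilinear_def
  by (auto intro!: linearI simp: matrix_vector_mult_add_rdistrib matrix_vector_right_distrib
      scaleR_matrix_vector_assoc matrix_vector_mult_scaleR)

lemma mat_exp_conjugate_has_vector_derivative:
  assumes "(\<xi> has_vector_derivative v) (at s within S)"
  shows "((\<lambda>s. mat_exp ((t - s) *\<^sub>R B) *v \<xi> s) has_vector_derivative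
      mat_exp ((t - s) *\<^sub>R B) *v (v - B *v \<xi> s)) (at s within S)"
proof -
  have "((\<lambda>s. t - s) has_vector_derivative - 1) (at s within S)"
    by (auto intro!: derivative_eq_intros)
  from vector_diff_chain_within[OF this has_vector_derivative_at_within[OF mat_exp_has_vector_derivative[of B "t - s"]]]
  have "((\<lambda>s. mat_exp ((t - s) *\<^sub>R B)) has_vector_derivative - (mat_exp ((t - s) *\<^sub>R B) ** B)) (at s within S)"
    by (simp add: o_def)
  from bounded_bilinear.has_vector_derivative[OF bounded_bilinear_matrix_vector_mult this assms]
  show ?thesis
    by (simp add: matrix_vector_mult_diff_distrib matrix_vector_mul_assoc
        bounded_bilinear.minus_left[OF bounded_bilinear_matrix_vector_mult])
qed

subsection \<open>Existence for globally Lipschitz fields\<close>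

text \<open>Integration gains a factor \<open>1 / \<mu>\<close> in the exponentially weighted norm;
  this is what makes the Picard operator contract.\<close>

lemma norm_integral_exp_le:
  fixes h :: "real \<Rightarrow> 'a::euclidean_space"
  assumes "continuous_on {0..t} h" and le: "\<And>s. s \<in> {0..t} \<Longrightarrow> norm (h s) \<le> b * exp (\<mu> * s)"
    and "0 \<le> t" "0 < \<mu>" "0 \<le> b"
  shows "norm (integral {0..t} h) \<le> b / \<mu> * exp (\<mu> * t)"
proof -
  have int: "((\<lambda>s. b * exp (\<mu> * s)) has_integral b / \<mu> * exp (\<mu> * t) - b / \<mu> * exp (\<mu> * 0)) {0..t}"
    using \<open>0 < \<mu>\<close> by (intro fundamental_theorem_of_calculus \<open>0 \<le> t\<close>)
      (auto intro!: derivative_eq_intros simp flip: has_real_derivative_iff_has_vector_derivative)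
  have "norm (integral {0..t} h) \<le> integral {0..t} (\<lambda>s. b * exp (\<mu> * s))"
    by (intro integral_norm_bound_integral integrable_continuous_interval assms continuous_intros)
  also have "\<dots> \<le> b / \<mu> * exp (\<mu> * t)"
    using assms integral_unique[OF int] by simp
  finally show ?thesis .
qed

text \<open>Near \<open>t\<close> the half-line agrees with the compact interval
  \<open>{0..t + 1}\<close>, where the fundamental theorem applies.\<close>

lemma integral_has_vector_derivative_atLeast:
  fixes h :: "real \<Rightarrow> 'a::banach"
  assumes "continuous_on {0..} h" "0 \<le> t"
  shows "((\<lambda>t. integral {0..t} h) has_vector_derivative h t) (at t within {0..})"
proof -
  have "((\<lambda>t. integral {0..t} h) has_vector_derivative h t) (at t within {0..t + 1})"
    using assms by (intro integral_has_vector_derivative) (auto intro: continuous_on_subset)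
  moreover have "at t within {0..t + 1} = at t within {0..}"
    by (rule at_within_nhd[of t "{..<t + 1}"]) auto
  ultimately show ?thesis by simp
qed

text \<open>
  With \<open>y t = exp (2 * (C + 1) * t) *\<^sub>R z t\<close>, the Picard operator becomes a contraction with constant \<open>1/2\<close>
  on bounded continuous functions \<open>z\<close> of all times at once.
\<close>

lemma lipschitz_ode_exists:
  fixes g :: "'a::euclidean_space \<Rightarrow> 'a"
  assumes "C-lipschitz_on UNIV g"
  obtains y where "y 0 = x0" "\<And>t. 0 \<le> t \<Longrightarrow> (y has_vector_derivative g (y t)) (at t within {0..})"
proof -
  \<comment> \<open>The factor 2 yields \<open>C / \<mu> \<le> 1 / 2\<close>; adding 1 keeps
    \<open>\<mu>\<close> positive when \<open>C = 0\<close>.\<close>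
  define \<mu> where "\<mu> = 2 * (C + 1)"
  have C: "0 \<le> C" using assms by (rule lipschitz_on_nonneg)
  have \<mu>: "0 < \<mu>" "C / \<mu> \<le> 1 / 2" using C by (auto simp: \<mu>_def field_simps)
  have g: "norm (g x - g y) \<le> C * norm (x - y)" for x y
    using lipschitz_onD[OF assms, of x y] by (simp add: dist_norm)
  have g_cont: "continuous_on UNIV g"
    using assms by (rule lipschitz_on_continuous_on)
  define h :: "(real \<Rightarrow>\<^sub>C 'a) \<Rightarrow> real \<Rightarrow> 'a" where "h z s = g (exp (\<mu> * s) *\<^sub>R z s)" for z s
  have h_cont: "continuous_on S (h z)" for S z
    unfolding h_def by (intro continuous_on_compose2[OF g_cont] continuous_intros) auto
  define P where "P z t = x0 + integral {0..t} (h z)" for z t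
  \<comment> \<open>\<open>P\<close> is the Picard operator and \<open>F\<close> its weighted form.
    Elements of the function space live on the whole line, so \<open>max t 0\<close> extends
    \<open>F z\<close> constantly to negative times.\<close>
  define F where "F z t = exp (- \<mu> * max t 0) *\<^sub>R P z (max t 0)" for z t
  have P_deriv: "(P z has_vector_derivative h z t) (at t within {0..})" if "0 \<le> t" for z t
    unfolding P_def
    using has_vector_derivative_add[OF has_vector_derivative_const
      integral_has_vector_derivative_atLeast[OF h_cont that]] by simp
  have P_cont: "continuous_on {0..} (P z)" for z
    using has_vector_derivative_continuous[OF P_deriv] by (auto simp: continuous_on_eq_continuous_within)
  have F: "F z \<in> bcontfun" for z
  proof (rule bcontfun_normI)
    show "continuous_on UNIV (F z)"
      unfolding F_def by (intro continuous_intros continuous_on_compose2[OF P_cont]) auto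
    fix t :: real
    let ?t = "max t 0"
    have "norm (h z s) \<le> (norm (g 0) + C * norm z) * exp (\<mu> * s)" if "s \<in> {0..?t}" for s
    proof -
      have "norm (h z s) \<le> norm (g 0) + C * (exp (\<mu> * s) * norm (z s))"
        using g[of "exp (\<mu> * s) *\<^sub>R z s" 0] norm_triangle_sub[of "h z s" "g 0"] by (simp add: h_def)
      also have "\<dots> \<le> norm (g 0) * exp (\<mu> * s) + C * (exp (\<mu> * s) * norm z)"
        using that C \<mu> mult_left_mono[of 1 "exp (\<mu> * s)" "norm (g 0)"]
        by (intro add_mono mult_left_mono norm_bounded) auto
      finally show ?thesis by (simp add: algebra_simps)
    qed
    then have "norm (integral {0..?t} (h z)) \<le> (norm (g 0) + C * norm z) / \<mu> * exp (\<mu> * ?t)"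
      using C \<mu> by (intro norm_integral_exp_le h_cont) auto
    moreover have "norm x0 \<le> norm x0 * exp (\<mu> * ?t)"
      using \<mu> mult_left_mono[of 1 "exp (\<mu> * ?t)" "norm x0"] by simp
    ultimately have "norm (P z ?t) \<le> (norm x0 + (norm (g 0) + C * norm z) / \<mu>) * exp (\<mu> * ?t)"
      unfolding P_def distrib_right by (intro norm_triangle_le add_mono)
    then show "norm (F z t) \<le> norm x0 + (norm (g 0) + C * norm z) / \<mu>"
      by (simp add: F_def exp_minus divide_simps)
  qed
  have "\<exists>!z. Bcontfun (F z) = z"
  proof (rule banach_fix_type)
    show "\<forall>z z'. dist (Bcontfun (F z)) (Bcontfun (F z')) \<le> 1 / 2 * dist z z'"
    proof (intro allI dist_bound)
      fix z z' :: "real \<Rightarrow>\<^sub>C 'a" and t :: real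
      let ?t = "max t 0"
      have "norm (h z s - h z' s) \<le> C * dist z z' * exp (\<mu> * s)" for s
      proof -
        have "norm (h z s - h z' s) \<le> C * (exp (\<mu> * s) * norm (z s - z' s))"
          using g[of "exp (\<mu> * s) *\<^sub>R z s" "exp (\<mu> * s) *\<^sub>R z' s"]
          by (simp add: h_def flip: scaleR_diff_right)
        also have "\<dots> \<le> C * (exp (\<mu> * s) * dist z z')"
          using C dist_bounded[of z s z'] by (intro mult_left_mono) (auto simp: dist_norm)
        finally show ?thesis by (simp add: mult_ac)
      qed
      then have "norm (integral {0..?t} (\<lambda>s. h z s - h z' s)) \<le> C * dist z z' / \<mu> * exp (\<mu> * ?t)"
        using C \<mu> by (intro norm_integral_exp_le continuous_intros h_cont) auto
      also have "integral {0..?t} (\<lambda>s. h z s - h z' s) = P z ?t - P z' ?t"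
        by (simp add: P_def integral_diff integrable_continuous_interval h_cont)
      finally have "dist (F z t) (F z' t) \<le> C / \<mu> * dist z z'"
        using \<mu>(1) by (simp add: F_def dist_norm exp_minus divide_simps flip: scaleR_diff_right)
      also have "\<dots> \<le> 1 / 2 * dist z z'"
        using \<mu>(2) by (rule mult_right_mono) simp
      finally show "dist (apply_bcontfun (Bcontfun (F z)) t) (apply_bcontfun (Bcontfun (F z')) t) \<le> 1 / 2 * dist z z'"
        by (simp add: Bcontfun_inverse F)
    qed
  qed auto
  then obtain z where "Bcontfun (F z) = z" by blast
  then have "z t = F z t" for t using Bcontfun_inverse[OF F] by metis
  \<comment> \<open>The weights cancel at the fixed point, so \<open>P z\<close> itself solves the
    integral equation.\<close>
  then have z: "h z t = g (P z t)" if "0 \<le> t" for t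
    using that by (simp add: h_def F_def exp_minus)
  show thesis
  proof
    show "P z 0 = x0" by (simp add: P_def)
    show "(P z has_vector_derivative g (P z t)) (at t within {0..})" if "0 \<le> t" for t
      using P_deriv[OF that, of z] z[OF that] by simp
  qed
qed

subsection \<open>State-dependent coefficient systems\<close>

text \<open>The infimum of a closed nonempty set belongs to it. This drives the continuation
  arguments below; \<open>t0 = 0\<close> is allowed.\<close>

lemma first_crossing:
  fixes h :: "real \<Rightarrow> real"
  assumes "continuous_on {0..} h" "0 \<le> t" "0 \<le> h t"
  obtains t0 where "0 \<le> t0" "0 \<le> h t0" "\<forall>s\<in>{0..<t0}. h s < 0"
proof -
  define S where "S = {s \<in> {0..}. 0 \<le> h s}"
  have "closed S"
    unfolding S_def by (intro continuous_on_closed_Collect_le assms continuous_intros closed_atLeast)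
  moreover have bdd: "bdd_below S" by (auto simp: S_def intro!: bdd_belowI[of _ 0])
  moreover have "t \<in> S" using assms by (simp add: S_def)
  ultimately have "Inf S \<in> S" using closed_contains_Inf by blast
  moreover have "h s < 0" if "0 \<le> s" "s < Inf S" for s
    using cInf_lower[OF _ bdd, of s] that by (force simp: S_def not_le)
  ultimately show thesis by (intro that[of "Inf S"]) (auto simp: S_def)
qed

section \<open>Regularity and uniqueness of solutions on the half-line\<close>

lemma ode_solution_continuous_on:
  assumes "\<And>t. 0 \<le> t \<Longrightarrow> (y has_vector_derivative y' t) (at t within {0..})"
  shows "continuous_on {0..} y"
  using has_vector_derivative_continuous[OF assms] by (auto simp: continuous_on_eq_continuous_within)

lemma ode_solution_at:
  assumes "\<And>t. 0 \<le> t \<Longrightarrow> (y has_vector_derivative y' t) (at t within {0..})" "0 < t"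
  shows "(y has_vector_derivative y' t) (at t)"
  using assms(1)[of t] at_within_interior[of t "{0..}"] assms(2) by (simp add: interior_real_atLeast)

text \<open>Gronwall in energy form: \<open>exp (- 2 * C * s)\<close> times the squared distance of
  the solutions cannot increase. Only a set \<open>S\<close> holding both solutions is involved, as
  \<open>A x *v x\<close> is Lipschitz merely on bounded sets.\<close>

lemma lipschitz_ode_unique:
  fixes y z :: "real \<Rightarrow> 'a::real_inner"
  assumes lip: "C-lipschitz_on S f" and S: "\<And>t. 0 \<le> t \<Longrightarrow> y t \<in> S" "\<And>t. 0 \<le> t \<Longrightarrow> z t \<in> S"
    and y: "\<And>t. 0 \<le> t \<Longrightarrow> (y has_vector_derivative f (y t)) (at t within {0..})"
    and z: "\<And>t. 0 \<le> t \<Longrightarrow> (z has_vector_derivative f (z t)) (at t within {0..})"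
    and "y 0 = z 0" "0 \<le> t"
  shows "y t = z t"
proof -
  define d where "d s = y s - z s" for s
  define E where "E s = - (exp (- 2 * C * s) * (d s \<bullet> d s))" for s
  have "E 0 \<le> E t"
  proof (rule DERIV_nonneg_imp_increasing_open[OF \<open>0 \<le> t\<close>])
    have "continuous_on {0..t} y" "continuous_on {0..t} z"
      using ode_solution_continuous_on[OF y] ode_solution_continuous_on[OF z]
      by (auto intro: continuous_on_subset)
    then show "continuous_on {0..t} E"
      unfolding E_def d_def by (intro continuous_intros)
    fix s assume s: "0 < s" "s < t"
    let ?v = "f (y s) - f (z s)"
    have "(d has_vector_derivative ?v) (at s)"
      unfolding d_def using ode_solution_at[OF y s(1)] ode_solution_at[OF z s(1)]
      by (rule has_vector_derivative_diff)
    from bounded_bilinear.has_vector_derivative[OF bounded_bilinear_inner this this]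
    have "((\<lambda>s. d s \<bullet> d s) has_real_derivative 2 * (d s \<bullet> ?v)) (at s)"
      by (simp add: has_real_derivative_iff_has_vector_derivative inner_commute)
    then have "(E has_real_derivative exp (- 2 * C * s) * (2 * (C * (d s \<bullet> d s) - d s \<bullet> ?v))) (at s)"
      unfolding E_def by (auto intro!: derivative_eq_intros simp: algebra_simps)
    moreover have "d s \<bullet> ?v \<le> C * (d s \<bullet> d s)"
    proof -
      have "d s \<bullet> ?v \<le> norm (d s) * norm ?v" by (rule norm_cauchy_schwarz)
      also have "\<dots> \<le> norm (d s) * (C * norm (d s))"
        using lipschitz_onD[OF lip S(1) S(2), of s s] s
        by (intro mult_left_mono) (auto simp: dist_norm d_def)
      finally show ?thesis by (simp add: dot_square_norm power2_eq_square mult_ac)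
    qed
    ultimately show "\<exists>e. (E has_real_derivative e) (at s) \<and> 0 \<le> e" by auto
  qed
  then have "exp (- 2 * C * t) * (d t \<bullet> d t) \<le> 0"
    using \<open>y 0 = z 0\<close> by (simp add: E_def d_def)
  then have "d t \<bullet> d t \<le> 0" by (simp add: mult_le_0_iff not_le[of _ "exp _"])
  then have "d t = 0" using inner_gt_zero_iff[of "d t"] by linarith
  then show ?thesis by (simp add: d_def)
qed

section \<open>Lipschitz estimates for the field \<open>A x *v x\<close>\<close>

lemma lipschitz_matrix_norm:
  fixes N :: "real ^ 'n \<Rightarrow> real"
  assumes N: "is_norm N" and lip: "\<And>x y. op_norm N (A x - A y) \<le> C * N (x - y)"
  obtains D where "0 \<le> D" "\<And>x y v. norm ((A x - A y) *v v) \<le> D * norm (x - y) * norm v"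
proof -
  obtain c where c: "0 < c" "\<And>x. N x \<le> c * norm x"
    using is_norm_le_norm[OF N] by blast
  obtain d where d: "0 < d" "\<And>x. norm x \<le> d * N x"
    using norm_le_is_norm[OF N] by blast
  show thesis
  proof
    show "0 \<le> d * \<bar>C\<bar> * c * c" using c d by simp
    fix x y v
    have "norm ((A x - A y) *v v) \<le> d * N ((A x - A y) *v v)" by (rule d)
    also have "\<dots> \<le> d * (op_norm N (A x - A y) * N v)"
      using d(1) by (intro mult_left_mono op_norm_ge N) auto
    \<comment> \<open>The sign of \<open>C\<close> is unknown; \<open>\<bar>C\<bar>\<close> keeps
      the products monotone.\<close>
    also have "\<dots> \<le> d * ((\<bar>C\<bar> * (c * norm (x - y))) * (c * norm v))"
    proof (intro mult_left_mono mult_mono c)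
      have "op_norm N (A x - A y) \<le> \<bar>C\<bar> * N (x - y)"
        using lip[of x y] mult_right_mono[OF abs_ge_self[of C] is_normD(1)[OF N, of "x - y"]] by linarith
      also have "\<dots> \<le> \<bar>C\<bar> * (c * norm (x - y))" by (intro mult_left_mono c) simp
      finally show "op_norm N (A x - A y) \<le> \<bar>C\<bar> * (c * norm (x - y))" .
    qed (use c d is_normD(1)[OF N] in auto)
    finally show "norm ((A x - A y) *v v) \<le> d * \<bar>C\<bar> * c * c * norm (x - y) * norm v"
      by (simp add: mult_ac)
  qed
qed

lemma sdc_field_lipschitz_on:
  fixes N :: "real ^ 'n \<Rightarrow> real"
  assumes N: "is_norm N" and lip: "\<And>x y. op_norm N (A x - A y) \<le> C * N (x - y)" and "0 \<le> R"
  obtains D where "D-lipschitz_on (cball 0 R) (\<lambda>x. A x *v x)"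
proof -
  obtain D where D: "0 \<le> D" "\<And>x y v. norm ((A x - A y) *v v) \<le> D * norm (x - y) * norm v"
    using lipschitz_matrix_norm[OF N lip] by blast
  let ?a = "onorm ((*v) (A 0))"
  have a: "norm (A 0 *v v) \<le> ?a * norm v" for v
    by (intro onorm matrix_vector_mul_bounded_linear)
  have a0: "0 \<le> ?a" by (intro onorm_pos_le matrix_vector_mul_bounded_linear)
  have "(D * R + (?a + D * R))-lipschitz_on (cball 0 R) (\<lambda>x. A x *v x)"
  proof (rule lipschitz_onI)
    show "0 \<le> D * R + (?a + D * R)" using D a0 \<open>0 \<le> R\<close> by simp
    fix x y :: "real ^ 'n" assume xy: "x \<in> cball 0 R" "y \<in> cball 0 R"
    \<comment> \<open>Comparing \<open>A y\<close> with \<open>A 0\<close> avoids a separate bound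
      for \<open>A\<close> on the ball.\<close>
    have "A x *v x - A y *v y = (A x - A y) *v x + (A 0 *v (x - y) + (A y - A 0) *v (x - y))"
      by (simp add: matrix_vector_mult_diff_distrib matrix_vector_mult_diff_rdistrib)
    then have "norm (A x *v x - A y *v y)
        \<le> norm ((A x - A y) *v x) + (norm (A 0 *v (x - y)) + norm ((A y - A 0) *v (x - y)))"
      by (simp only:) (intro norm_triangle_le add_left_mono norm_triangle_ineq)
    also have "\<dots> \<le> D * norm (x - y) * norm x + (?a * norm (x - y) + D * norm (y - 0) * norm (x - y))"
      by (intro add_mono D a)
    also have "\<dots> \<le> D * norm (x - y) * R + (?a * norm (x - y) + D * R * norm (x - y))"
      using xy D by (intro add_mono mult_left_mono mult_right_mono) auto
    finally show "dist (A x *v x) (A y *v y) \<le> (D * R + (?a + D * R)) * dist x y"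
      by (simp add: dist_norm algebra_simps)
  qed
  then show thesis by (rule that)
qed

lemma forward_invariantD:
  assumes "forward_invariant A X" "is_interval J" "0 \<in> J" "sdc_solution A J \<xi>" "\<xi> 0 \<in> X"
    and "t \<in> J" "0 \<le> t"
  shows "\<xi> t \<in> X"
  using assms by (auto simp: forward_invariant_def)

text \<open>
  The field is truncated outside a ball larger than \<open>X\<close>; forward invariance on the initial interval
  spent in that ball shows that the truncated solution never reaches its boundary.
\<close>

lemma sdc_solution_exists:
  fixes A :: "real ^ 'n \<Rightarrow> real ^ 'n ^ 'n"
  assumes lip: "\<And>R. 0 \<le> R \<Longrightarrow> \<exists>D. D-lipschitz_on (cball 0 R) (\<lambda>x. A x *v x)"
    and "bounded X" and inv: "forward_invariant A X" and "x0 \<in> X"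
  obtains \<xi> where "sdc_solution A {0..} \<xi>" "\<xi> 0 = x0"
proof -
  obtain r where r: "0 < r" "\<And>x. x \<in> X \<Longrightarrow> norm x \<le> r"
    using \<open>bounded X\<close> by (auto simp: bounded_pos)
  \<comment> \<open>The gap between \<open>r\<close> and \<open>R\<close> yields the contradiction:
    invariance gives norm at most \<open>r\<close>, an exit would need \<open>R\<close>.\<close>
  define R where "R = r + 1"
  have R: "0 < R" "r < R" using r by (auto simp: R_def)
  let ?p = "closest_point (cball (0 :: real ^ 'n) R)" and ?f = "\<lambda>x. A x *v x"
  have ne: "cball (0 :: real ^ 'n) R \<noteq> {}" using R by simp
  obtain D where D: "D-lipschitz_on (cball 0 R) ?f" using lip[of R] R by auto
  have "1-lipschitz_on UNIV ?p"
    using closest_point_lipschitz[OF convex_cball closed_cball ne] by (intro lipschitz_onI) auto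
  moreover have "D-lipschitz_on (range ?p) ?f"
    using closest_point_in_set[OF closed_cball ne] by (intro lipschitz_on_subset[OF D]) auto
  ultimately have "(D * 1)-lipschitz_on UNIV (\<lambda>x. ?f (?p x))"
    by (rule lipschitz_on_compose2)
  then obtain y where y: "y 0 = x0"
      "\<And>t. 0 \<le> t \<Longrightarrow> (y has_vector_derivative ?f (?p (y t))) (at t within {0..})"
    using lipschitz_ode_exists[of "D * 1" "\<lambda>x. ?f (?p x)" x0] by blast
  have y_cont: "continuous_on {0..} y" using y(2) by (rule ode_solution_continuous_on)
  have inside: "norm (y t) < R" if "0 \<le> t" for t
  proof (rule ccontr)
    assume "\<not> norm (y t) < R"
    then have ge: "0 \<le> norm (y t) - R" by simp
    have "continuous_on {0..} (\<lambda>s. norm (y s) - R)"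
      by (intro continuous_intros y_cont)
    then obtain t0 where t0: "0 \<le> t0" "0 \<le> norm (y t0) - R"
        "\<forall>s\<in>{0..<t0}. norm (y s) - R < 0"
      by (rule first_crossing[where h="\<lambda>s. norm (y s) - R", OF _ \<open>0 \<le> t\<close> ge])
    have "t0 \<noteq> 0" using t0(2) y(1) r(2)[OF \<open>x0 \<in> X\<close>] R by auto
    then have pos: "0 < t0" using t0(1) by simp
    \<comment> \<open>Before \<open>t0\<close> the projection \<open>?p\<close> acts as the
      identity, so \<open>y\<close> solves the original system there; the bound \<open>r\<close>
      then passes to \<open>t0\<close> by continuity.\<close>
    have "sdc_solution A {0..<t0} y"
      unfolding sdc_solution_def
    proof
      fix s assume s: "s \<in> {0..<t0}"
      then have "?p (y s) = y s"
        using t0(3) by (intro closest_point_self) (auto intro: less_imp_le)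
      then show "(y has_vector_derivative A (y s) *v y s) (at s within {0..<t0})"
        using has_vector_derivative_within_subset[OF y(2), of s "{0..<t0}"] s
        by (auto simp: subset_iff)
    qed
    then have "norm (y s) \<le> r" if "s \<in> {0..<t0}" for s
      using forward_invariantD[OF inv is_interval_co, of 0 t0 y s] that pos y(1) \<open>x0 \<in> X\<close> r(2) by simp
    moreover have "continuous_on (closure {0..<t0}) (\<lambda>s. norm (y s))"
      using pos by (intro continuous_on_norm continuous_on_subset[OF y_cont]) simp
    ultimately have "norm (y t0) \<le> r"
      using pos continuous_le_on_closure[of "{0..<t0}" "\<lambda>s. norm (y s)" t0 r] by simp
    then show False using t0(2) R by simp
  qed
  have "sdc_solution A {0..} y"
    unfolding sdc_solution_def
  proof
    fix s :: real assume "s \<in> {0..}"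
    then show "(y has_vector_derivative A (y s) *v y s) (at s within {0..})"
      using y(2)[of s] closest_point_self[of "y s" "cball 0 R"] inside[of s] by simp
  qed
  then show thesis using y(1) by (rule that)
qed

subsection \<open>The growth estimate\<close>

text \<open>
  Freezing at the time \<open>r\<close> with \<open>t - r = ln 2 / \<mu>\<close> splits the weight \<open>exp (\<mu> * s)\<close> on \<open>s \<le> t\<close> into two
  equal halves, so \<open>r\<close> is its median and minimises the integral of \<open>\<bar>s - r\<bar> * exp (\<mu> * s)\<close>; this is
  the source of \<open>ln 2\<close>. Below, \<open>x = \<mu> * t\<close>, \<open>y = \<mu> * r\<close>, and the left-hand side is \<open>\<mu>\<^sup>2\<close> times
  that integral over \<open>0 \<le> s \<le> t\<close>.
\<close>

lemma median_weight_le: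
  fixes x :: real
  assumes "0 \<le> x" and y: "y = max 0 (x - ln 2)"
  shows "exp x * (x - y - 1) + 2 * exp y - y - 1 \<le> ln 2 * (exp x - 1)"
proof (cases "ln 2 \<le> x")
  case True
  then have yx: "y = x - ln 2" using y by simp
  then have "2 * exp y = exp x" "exp x * (x - y - 1) = ln 2 * exp x - exp x"
    unfolding yx by (simp_all add: exp_diff algebra_simps)
  moreover have "ln 2 \<le> (1 :: real)" using ln_le_minus_one[of "2 :: real"] by simp
  ultimately show ?thesis using True yx by (simp add: right_diff_distrib)
next
  case False
  define g where "g x = ln 2 * (exp x - 1) - exp x * (x - 1) - 1" for x :: real
  have "g 0 \<le> g x"
  proof (rule DERIV_nonneg_imp_nondecreasing[OF \<open>0 \<le> x\<close>])
    fix s assume "0 \<le> s" "s \<le> x"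
    then have "0 \<le> exp s * (ln 2 - s)" using False by simp
    moreover have "(g has_real_derivative exp s * (ln 2 - s)) (at s)"
      unfolding g_def by (auto intro!: derivative_eq_intros simp: algebra_simps)
    ultimately show "\<exists>e. (g has_real_derivative e) (at s) \<and> 0 \<le> e" by blast
  qed
  moreover have "y = 0" using False y by simp
  ultimately show ?thesis by (simp add: g_def algebra_simps)
qed

text \<open>The hypothesis covers only \<open>s > 0\<close>; continuity extends the bound to
  \<open>s = 0\<close>, where it reads \<open>N v \<le> K * N v\<close>.\<close>

lemma mat_exp_mult_le:
  assumes N: "is_norm N" and le: "\<And>s. 0 < s \<Longrightarrow> op_norm N (mat_exp (s *\<^sub>R B)) \<le> K * exp (- \<omega> * s)"
    and "0 \<le> s"
  shows "N (mat_exp (s *\<^sub>R B) *v v) \<le> K * exp (- \<omega> * s) * N v"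
proof -
  have "continuous_on UNIV (\<lambda>s. mat_exp (s *\<^sub>R B))"
    by (auto simp: continuous_on_eq_continuous_within intro: has_vector_derivative_continuous
        mat_exp_has_vector_derivative)
  then have "continuous_on UNIV (\<lambda>s. mat_exp (s *\<^sub>R B) *v v)"
    by (intro bounded_bilinear.continuous_on[OF bounded_bilinear_matrix_vector_mult] continuous_intros)
  then have "continuous_on UNIV (\<lambda>s. N (mat_exp (s *\<^sub>R B) *v v))"
    by (rule continuous_on_compose2[OF is_norm_continuous_on[OF N, of UNIV]]) simp
  then have "continuous_on (closure {0<..}) (\<lambda>s. N (mat_exp (s *\<^sub>R B) *v v) - K * exp (- \<omega> * s) * N v)"
    by (intro continuous_intros) (auto intro: continuous_on_subset)
  then have "N (mat_exp (s *\<^sub>R B) *v v) - K * exp (- \<omega> * s) * N v \<le> 0"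
  proof (rule continuous_le_on_closure)
    show "s \<in> closure {0<..}" using \<open>0 \<le> s\<close> by simp
    fix r :: real assume "r \<in> {0<..}"
    then show "N (mat_exp (r *\<^sub>R B) *v v) - K * exp (- \<omega> * r) * N v \<le> 0"
      using op_norm_ge[OF N, of "mat_exp (r *\<^sub>R B)" v] le[of r]
        mult_right_mono[OF _ is_normD(1)[OF N, of v]] by force
  qed
  then show ?thesis by simp
qed

section \<open>Growth along one fixed solution\<close>

context
  fixes N :: "real ^ 'n \<Rightarrow> real" and A :: "real ^ 'n \<Rightarrow> real ^ 'n ^ 'n" and \<xi> :: "real \<Rightarrow> real ^ 'n"
    and K L M \<omega> :: real
  assumes N: "is_norm N"
    and K: "0 < K" and L: "0 \<le> L"
    and sol: "\<And>s. 0 \<le> s \<Longrightarrow> (\<xi> has_vector_derivative A (\<xi> s) *v \<xi> s) (at s within {0..})"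
    and speed: "\<And>s. 0 \<le> s \<Longrightarrow> N (A (\<xi> s) *v \<xi> s) \<le> M"
    and lip: "\<And>s r. 0 \<le> s \<Longrightarrow> 0 \<le> r \<Longrightarrow> op_norm N (A (\<xi> s) - A (\<xi> r)) \<le> L * N (\<xi> s - \<xi> r)"
    and exp_le: "\<And>r s. 0 \<le> r \<Longrightarrow> 0 < s \<Longrightarrow> op_norm N (mat_exp (s *\<^sub>R A (\<xi> r))) \<le> K * exp (- \<omega> * s)"
begin

lemma sdc_displacement_le:
  assumes "0 \<le> r" "0 \<le> s"
  shows "N (\<xi> s - \<xi> r) \<le> M * \<bar>s - r\<bar>"
proof -
  have *: "N (\<xi> b - \<xi> a) \<le> M * (b - a)" if "0 \<le> a" "a \<le> b" for a b
  proof -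
    have "N (\<xi> b - \<xi> a) \<le> M * b - M * a"
    proof (rule is_norm_increment_le[OF N \<open>a \<le> b\<close>])
      show "continuous_on {a..b} \<xi>"
        using that by (auto intro: continuous_on_subset[OF ode_solution_continuous_on[OF sol]])
      show "(\<xi> has_vector_derivative A (\<xi> s) *v \<xi> s) (at s)" if "a < s" "s < b" for s
        using that \<open>0 \<le> a\<close> by (intro ode_solution_at[OF sol]) auto
      show "((*) M has_real_derivative M) (at s)" for s
        by (auto intro!: derivative_eq_intros)
      show "N (A (\<xi> s) *v \<xi> s) \<le> M" if "a < s" "s < b" for s
        using that \<open>0 \<le> a\<close> by (intro speed) auto
    qed (intro continuous_intros)
    then show ?thesis by (simp add: algebra_simps)
  qed
  show ?thesis
    using *[of r s] *[of s r] is_normD(6)[OF N, of "\<xi> s" "\<xi> r"] assms by (cases "r \<le> s") auto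
qed

lemma frozen_perturbation_le:
  assumes "0 \<le> r" "0 \<le> s" "s \<le> t"
  shows "N (mat_exp ((t - s) *\<^sub>R A (\<xi> r)) *v (A (\<xi> s) *v \<xi> s - A (\<xi> r) *v \<xi> s))
    \<le> K * L * M * \<bar>s - r\<bar> * exp (- \<omega> * t) * (exp (\<omega> * s) * N (\<xi> s))"
proof -
  let ?v = "(A (\<xi> s) - A (\<xi> r)) *v \<xi> s"
  have "op_norm N (A (\<xi> s) - A (\<xi> r)) \<le> L * (M * \<bar>s - r\<bar>)"
    using lip[of s r] mult_left_mono[OF sdc_displacement_le L, of r s] assms by linarith
  then have "N ?v \<le> L * (M * \<bar>s - r\<bar>) * N (\<xi> s)"
    using op_norm_ge[OF N, of "A (\<xi> s) - A (\<xi> r)" "\<xi> s"] mult_right_mono[OF _ is_normD(1)[OF N]]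
    by (meson order_trans)
  then have "K * exp (- \<omega> * (t - s)) * N ?v
      \<le> K * exp (- \<omega> * (t - s)) * (L * (M * \<bar>s - r\<bar>) * N (\<xi> s))"
    using K by (intro mult_left_mono) auto
  moreover have "N (mat_exp ((t - s) *\<^sub>R A (\<xi> r)) *v ?v) \<le> K * exp (- \<omega> * (t - s)) * N ?v"
    using assms by (intro mat_exp_mult_le N exp_le) auto
  moreover have "exp (- \<omega> * (t - s)) = exp (- \<omega> * t) * exp (\<omega> * s)"
    by (simp add: algebra_simps flip: exp_add)
  ultimately show ?thesis
    by (simp add: matrix_vector_mult_diff_rdistrib mult_ac)
qed

text \<open>An exponential bound before \<open>t\<close> is fed through the integral inequality. The
  term \<open>- 1\<close> in the result improves the bound at \<open>t\<close> whenever
  \<open>K * N (\<xi> 0) < D\<close>.\<close>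

lemma sdc_growth_step:
  assumes "0 < \<mu>" and c: "K * L * M * ln 2 \<le> \<mu>\<^sup>2" and "0 \<le> t" "0 \<le> D"
    and prev: "\<And>s. 0 \<le> s \<Longrightarrow> s < t \<Longrightarrow> exp (\<omega> * s) * N (\<xi> s) \<le> D * exp (\<mu> * s)"
  shows "exp (\<omega> * t) * N (\<xi> t) \<le> K * N (\<xi> 0) + D * (exp (\<mu> * t) - 1)"
proof -
  define r where "r = max 0 (t - ln 2 / \<mu>)"
  have ln2: "0 < ln (2 :: real)" by simp
  have r: "0 \<le> r" "r \<le> t" using \<open>0 \<le> t\<close> \<open>0 < \<mu>\<close> by (auto simp: r_def)
  define B where "B = A (\<xi> r)"
  define w where "w s = mat_exp ((t - s) *\<^sub>R B) *v \<xi> s" for s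
  define w' where "w' s = mat_exp ((t - s) *\<^sub>R B) *v (A (\<xi> s) *v \<xi> s - B *v \<xi> s)" for s
  have w: "(w has_vector_derivative w' s) (at s within {0..})" if "0 \<le> s" for s
    unfolding w_def w'_def by (intro mat_exp_conjugate_has_vector_derivative sol that)
  have w_cont: "continuous_on {a..b} w" if "0 \<le> a" for a b
    using that by (auto intro: continuous_on_subset[OF ode_solution_continuous_on[OF w]])
  define q where "q = exp (- \<omega> * t) * D / ln 2"
  have w'_le: "N (w' s) \<le> q * \<mu>\<^sup>2 * \<bar>s - r\<bar> * exp (\<mu> * s)" if "0 < s" "s < t" for s
  proof -
    have "N (w' s) \<le> (K * L * M) * \<bar>s - r\<bar> * exp (- \<omega> * t) * (exp (\<omega> * s) * N (\<xi> s))"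
      unfolding w'_def B_def using that r by (intro frozen_perturbation_le) auto
    also have "\<dots> \<le> (\<mu>\<^sup>2 / ln 2) * \<bar>s - r\<bar> * exp (- \<omega> * t) * (D * exp (\<mu> * s))"
    proof (rule mult_mono)
      have "K * L * M \<le> \<mu>\<^sup>2 / ln 2" using c ln2 by (simp add: pos_le_divide_eq)
      then show "K * L * M * \<bar>s - r\<bar> * exp (- \<omega> * t) \<le> (\<mu>\<^sup>2 / ln 2) * \<bar>s - r\<bar> * exp (- \<omega> * t)"
        by (intro mult_right_mono) auto
    qed (use that prev[of s] is_normD(1)[OF N, of "\<xi> s"] in auto)
    finally show ?thesis by (simp add: q_def mult_ac)
  qed
  \<comment> \<open>An antiderivative of the majorant without the absolute value. Since
    \<open>s - r\<close> changes sign at \<open>r\<close>, \<open>\<phi>\<close> is used on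
    \<open>{r..t}\<close> and \<open>- \<phi>\<close> on \<open>{0..r}\<close>, for a total of
    \<open>\<phi> t - 2 * \<phi> r + \<phi> 0\<close>.\<close>
  define \<phi> where "\<phi> s = q * (exp (\<mu> * s) * (\<mu> * (s - r) - 1))" for s
  have \<phi>: "(\<phi> has_real_derivative q * \<mu>\<^sup>2 * (s - r) * exp (\<mu> * s)) (at s)" for s
    unfolding \<phi>_def by (auto intro!: derivative_eq_intros simp: algebra_simps power2_eq_square)
  have \<phi>_cont: "continuous_on S \<phi>" for S
    by (rule continuous_at_imp_continuous_on) (blast intro: DERIV_isCont[OF \<phi>])
  have "N (w t - w r) \<le> \<phi> t - \<phi> r"
  proof (rule is_norm_increment_le[where w=w and w'=w' and \<phi>=\<phi>
        and \<phi>'="\<lambda>s. q * \<mu>\<^sup>2 * (s - r) * exp (\<mu> * s)", OF N r(2) w_cont[OF r(1)]])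
    show "(w has_vector_derivative w' s) (at s)" if "r < s" for s
      using r(1) that by (intro ode_solution_at[OF w]) auto
    show "N (w' s) \<le> q * \<mu>\<^sup>2 * (s - r) * exp (\<mu> * s)" if "r < s" "s < t" for s
      using w'_le[of s] that r by simp
  qed (rule \<phi>_cont \<phi>)+
  moreover have "N (w r - w 0) \<le> - \<phi> r - - \<phi> 0"
  proof (rule is_norm_increment_le[where w=w and w'=w' and \<phi>="\<lambda>s. - \<phi> s"
        and \<phi>'="\<lambda>s. - (q * \<mu>\<^sup>2 * (s - r) * exp (\<mu> * s))", OF N r(1) w_cont[OF order_refl]])
    show "(w has_vector_derivative w' s) (at s)" if "0 < s" for s
      using w that by (rule ode_solution_at)
    show "continuous_on {0..r} (\<lambda>s. - \<phi> s)" by (intro continuous_on_minus \<phi>_cont)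
    show "((\<lambda>s. - \<phi> s) has_real_derivative - (q * \<mu>\<^sup>2 * (s - r) * exp (\<mu> * s))) (at s)" for s
      by (intro DERIV_minus \<phi>)
    show "N (w' s) \<le> - (q * \<mu>\<^sup>2 * (s - r) * exp (\<mu> * s))" if "0 < s" "s < r" for s
      using w'_le[of s] that r by (simp add: algebra_simps)
  qed
  moreover have "N (w 0) \<le> K * exp (- \<omega> * t) * N (\<xi> 0)"
    unfolding w_def B_def using mat_exp_mult_le[OF N exp_le[OF r(1)] \<open>0 \<le> t\<close>] by simp
  moreover have "w t = \<xi> t" using mat_exp_0[of B] by (simp add: w_def)
  ultimately have "N (\<xi> t) \<le> K * exp (- \<omega> * t) * N (\<xi> 0) + (\<phi> t - 2 * \<phi> r + \<phi> 0)"
    using is_normD(4)[OF N, of "w t - w r" "w r - w 0"] is_normD(4)[OF N, of "w t - w 0" "w 0"] by simp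
  also have "\<phi> t - 2 * \<phi> r + \<phi> 0 =
      q * (exp (\<mu> * t) * (\<mu> * t - \<mu> * r - 1) + 2 * exp (\<mu> * r) - \<mu> * r - 1)"
    by (simp add: \<phi>_def algebra_simps)
  also have "\<dots> \<le> q * (ln 2 * (exp (\<mu> * t) - 1))"
  proof (intro mult_left_mono median_weight_le)
    show "\<mu> * r = max 0 (\<mu> * t - ln 2)"
      using \<open>0 < \<mu>\<close> by (auto simp: r_def max_def field_simps)
    show "0 \<le> q" using \<open>0 \<le> D\<close> by (simp add: q_def)
  qed (use \<open>0 < \<mu>\<close> \<open>0 \<le> t\<close> in auto)
  also have "\<dots> = exp (- \<omega> * t) * (D * (exp (\<mu> * t) - 1))"
    using ln2 by (simp add: q_def)
  finally have "exp (\<omega> * t) * N (\<xi> t)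
      \<le> exp (\<omega> * t) * (exp (- \<omega> * t) * (K * N (\<xi> 0) + D * (exp (\<mu> * t) - 1)))"
    by (intro mult_left_mono) (auto simp: algebra_simps)
  then show ?thesis by (simp flip: exp_add mult.assoc)
qed

text \<open>At a first violation time the growth step would force
  \<open>D \<le> K * N (\<xi> 0)\<close>.\<close>

lemma sdc_growth_strict:
  assumes "0 < \<mu>" and c: "K * L * M * ln 2 \<le> \<mu>\<^sup>2" and "0 \<le> t" and D: "K * N (\<xi> 0) < D"
  shows "exp (\<omega> * t) * N (\<xi> t) < D * exp (\<mu> * t)"
proof (rule ccontr)
  let ?h = "\<lambda>t. exp (\<omega> * t) * N (\<xi> t) - D * exp (\<mu> * t)"
  assume "\<not> exp (\<omega> * t) * N (\<xi> t) < D * exp (\<mu> * t)"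
  then have ge: "0 \<le> ?h t" by simp
  have "continuous_on {0..} ?h"
    by (intro continuous_intros continuous_on_compose2[OF is_norm_continuous_on[OF N, of UNIV]]
        ode_solution_continuous_on[OF sol]) auto
  then obtain t0 where t0: "0 \<le> t0" "0 \<le> ?h t0" "\<forall>s\<in>{0..<t0}. ?h s < 0"
    by (rule first_crossing[where h="?h", OF _ \<open>0 \<le> t\<close> ge])
  have "0 \<le> D" using D K is_normD(1)[OF N, of "\<xi> 0"] by (smt (verit) mult_nonneg_nonneg)
  then have "exp (\<omega> * t0) * N (\<xi> t0) \<le> K * N (\<xi> 0) + D * (exp (\<mu> * t0) - 1)"
    using t0 by (intro sdc_growth_step[OF \<open>0 < \<mu>\<close> c]) force+
  then show False using t0(2) D by (simp add: algebra_simps)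
qed

lemma sdc_growth:
  assumes "0 \<le> t"
  shows "N (\<xi> t) \<le> K * exp (t * (sqrt (K * L * M * ln 2) - \<omega>)) * N (\<xi> 0)"
proof -
  let ?\<mu>0 = "sqrt (K * L * M * ln 2)" and ?u = "exp (\<omega> * t) * N (\<xi> t)"
  have "0 \<le> M" using speed[of 0] is_normD(1)[OF N] order_trans by blast
  then have c0: "0 \<le> K * L * M * ln 2" using K L by simp
  \<comment> \<open>The root may be 0 while the strict bound needs a positive rate, so a larger
    \<open>\<mu>\<close> is used and then lowered to the root.\<close>
  have le: "?u \<le> K * N (\<xi> 0) * exp (\<mu> * t)" if "?\<mu>0 < \<mu>" for \<mu>
  proof (rule field_le_epsilon)
    fix e :: real assume "0 < e"
    have \<mu>: "0 < \<mu>" using that real_sqrt_ge_zero[OF c0] by linarith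
    \<comment> \<open>This \<open>D\<close> exceeds \<open>K * N (\<xi> 0)\<close> by just enough to
      cost \<open>e\<close> at time \<open>t\<close>.\<close>
    have "?u < (K * N (\<xi> 0) + e / exp (\<mu> * t)) * exp (\<mu> * t)"
    proof (rule sdc_growth_strict[OF \<mu> _ \<open>0 \<le> t\<close>])
      show "K * L * M * ln 2 \<le> \<mu>\<^sup>2"
        using that \<mu> c0 by (metis less_imp_le real_sqrt_le_iff real_sqrt_unique)
    qed (use \<open>0 < e\<close> in simp)
    then show "?u \<le> K * N (\<xi> 0) * exp (\<mu> * t) + e" by (simp add: distrib_right)
  qed
  have "?u \<le> K * N (\<xi> 0) * exp (?\<mu>0 * t)"
  proof (rule tendsto_lowerbound)
    show "((\<lambda>\<mu>. K * N (\<xi> 0) * exp (\<mu> * t)) \<longlongrightarrow> K * N (\<xi> 0) * exp (?\<mu>0 * t)) (at_right ?\<mu>0)"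
      by (intro tendsto_intros)
    show "\<forall>\<^sub>F \<mu> in at_right ?\<mu>0. ?u \<le> K * N (\<xi> 0) * exp (\<mu> * t)"
      using le by (auto simp: eventually_at_filter)
  qed simp
  then have "exp (- \<omega> * t) * ?u \<le> exp (- \<omega> * t) * (K * N (\<xi> 0) * exp (?\<mu>0 * t))"
    by (rule mult_left_mono) simp
  also have "exp (- \<omega> * t) * ?u = N (\<xi> t)"
    by (simp flip: exp_add mult.assoc)
  also have "exp (- \<omega> * t) * (K * N (\<xi> 0) * exp (?\<mu>0 * t))
      = K * (exp (- \<omega> * t) * exp (?\<mu>0 * t)) * N (\<xi> 0)"
    by (simp only: mult_ac)
  also have "exp (- \<omega> * t) * exp (?\<mu>0 * t) = exp (t * (?\<mu>0 - \<omega>))"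
    by (simp add: algebra_simps flip: exp_add)
  finally show ?thesis .
qed

end

section \<open>Existence, uniqueness and the bound combined\<close>

theorem theorem2p7:
  fixes N :: "real ^ 'n \<Rightarrow> real"
    and A :: "real ^ 'n \<Rightarrow> real ^ 'n ^ 'n"
    and X :: "(real ^ 'n) set"
    and L K \<omega> M :: real
    and x0 :: "real ^ 'n"
  assumes norm: "is_norm N"
    and lipschitz: "\<exists>C. \<forall>x y. op_norm N (A x - A y) \<le> C * N (x - y)"
    and bounded: "bounded X"
    and invariant: "forward_invariant A X"
    and K_pos: "K > 0"
    and omega_pos: "\<omega> > 0"
    and lipschitz_X: "\<forall>x1\<in>X. \<forall>x2\<in>X. op_norm N (A x1 - A x2) \<le> L * N (x1 - x2)"
    and exp_bound: "\<forall>x\<in>X. \<forall>s>0. op_norm N (mat_exp (s *\<^sub>R A x)) \<le> K * exp (- \<omega> * s)"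
    and M: "M = (SUP x\<in>X. N (A x *v x))"
    and x0: "x0 \<in> X"
  shows "\<exists>\<xi>. sdc_solution A {0..} \<xi> \<and> \<xi> 0 = x0 \<and>
           (\<forall>\<eta>. sdc_solution A {0..} \<eta> \<and> \<eta> 0 = x0 \<longrightarrow> (\<forall>t\<ge>0. \<eta> t = \<xi> t)) \<and>
           (\<forall>t>0. N (\<xi> t) \<le> K * exp (t * (sqrt (K * L * M * ln 2) - \<omega>)) * N x0)"
proof -
  obtain C where C: "\<And>x y. op_norm N (A x - A y) \<le> C * N (x - y)"
    using lipschitz by blast
  have lip: "\<exists>D. D-lipschitz_on (cball 0 R) (\<lambda>x. A x *v x)" if "0 \<le> R" for R
    using sdc_field_lipschitz_on[OF norm C that] by blast
  obtain R where "0 < R" "\<forall>x\<in>X. norm x \<le> R"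
    using bounded by (auto simp: bounded_pos)
  then have R: "0 < R" "X \<subseteq> cball 0 R" by auto
  obtain D where D: "D-lipschitz_on (cball 0 R) (\<lambda>x. A x *v x)"
    using lip[of R] R by auto
  obtain \<xi> where \<xi>: "sdc_solution A {0..} \<xi>" "\<xi> 0 = x0"
    using sdc_solution_exists[OF lip bounded invariant x0] .
  have deriv: "(\<eta> has_vector_derivative A (\<eta> t) *v \<eta> t) (at t within {0..})"
    if "sdc_solution A {0..} \<eta>" "0 \<le> t" for \<eta> t
    using that by (simp add: sdc_solution_def)
  have inX: "\<eta> t \<in> X" if "sdc_solution A {0..} \<eta>" "\<eta> 0 = x0" "0 \<le> t" for \<eta> t
    using forward_invariantD[OF invariant is_interval_ci, of 0 \<eta> t] that x0 by simp
  have unique: "\<eta> t = \<xi> t" if \<eta>: "sdc_solution A {0..} \<eta>" "\<eta> 0 = x0" and "0 \<le> t" for \<eta> t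
    by (rule lipschitz_ode_unique[where y=\<eta> and z=\<xi>, OF lipschitz_on_subset[OF D R(2)]])
      (use \<eta> \<xi> deriv inX \<open>0 \<le> t\<close> in auto)
  \<comment> \<open>Boundedness of the speeds makes the supremum \<open>M\<close> a genuine upper
    bound.\<close>
  have "compact ((\<lambda>x. N (A x *v x)) ` cball 0 R)"
    by (intro compact_continuous_image continuous_on_compose2[OF is_norm_continuous_on[OF norm, of UNIV]]
        lipschitz_on_continuous_on[OF D]) auto
  then have bdd: "bdd_above ((\<lambda>x. N (A x *v x)) ` X)"
    using R(2) by (meson bdd_above_mono bounded_imp_bdd_above compact_imp_bounded image_mono)
  have speed: "N (A x *v x) \<le> M" if "x \<in> X" for x
    unfolding M using that bdd by (rule cSUP_upper)
  \<comment> \<open>The growth estimate assumes a nonnegative Lipschitz constant, so it is applied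
    with \<open>max L 0\<close>; for \<open>L < 0\<close> both products vanish because
    \<open>M = 0\<close>.\<close>
  have eq: "K * max L 0 * M = K * L * M"
  proof (cases "0 \<le> L")
    case False
    \<comment> \<open>a negative \<open>L\<close> forces \<open>X\<close> to be a single equilibrium\<close>
    have "x = x0" if "x \<in> X" for x
    proof -
      have "0 \<le> L * N (x - x0)"
        using lipschitz_X that x0 op_norm_nonneg[OF norm] order_trans by blast
      then have "N (x - x0) = 0"
        using False is_normD(1)[OF norm, of "x - x0"] by (simp add: zero_le_mult_iff)
      then show ?thesis using is_normD(2)[OF norm] by simp
    qed
    then have X: "X = {x0}" using x0 by blast
    then have const: "\<xi> s = x0" if "0 \<le> s" for s using inX[OF \<xi> that] by simp
    have "((\<lambda>s. x0) has_vector_derivative A x0 *v x0) (at s within {0..})" if "0 \<le> s" for s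
      using deriv[OF \<xi>(1) that] const that
      by (intro has_vector_derivative_transform[of s "{0..}" "\<lambda>s. x0" \<xi>]) auto
    \<comment> \<open>Time 1 is interior to the half-line, where the two-sided derivative is
      unique.\<close>
    then have "((\<lambda>s. x0) has_vector_derivative A x0 *v x0) (at 1)"
      by (rule ode_solution_at) simp_all
    then have "A x0 *v x0 = 0"
      using has_vector_derivative_const by (rule vector_derivative_unique_at)
    then show ?thesis using M X is_normD(2)[OF norm, of 0] by simp
  qed simp
  have bound: "N (\<xi> t) \<le> K * exp (t * (sqrt (K * max L 0 * M * ln 2) - \<omega>)) * N (\<xi> 0)" if "0 < t" for t
  proof (rule sdc_growth[where \<xi>=\<xi> and A=A, OF norm K_pos])
    show "op_norm N (A (\<xi> s) - A (\<xi> r)) \<le> max L 0 * N (\<xi> s - \<xi> r)" if "0 \<le> s" "0 \<le> r" for s r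
    proof -
      have "op_norm N (A (\<xi> s) - A (\<xi> r)) \<le> L * N (\<xi> s - \<xi> r)"
        using lipschitz_X inX[OF \<xi> that(1)] inX[OF \<xi> that(2)] by blast
      also have "\<dots> \<le> max L 0 * N (\<xi> s - \<xi> r)"
        by (intro mult_right_mono is_normD(1)[OF norm]) simp
      finally show ?thesis .
    qed
    show "op_norm N (mat_exp (s *\<^sub>R A (\<xi> r))) \<le> K * exp (- \<omega> * s)" if "0 \<le> r" "0 < s" for r s
      using exp_bound inX[OF \<xi> that(1)] that(2) by blast
    show "N (A (\<xi> s) *v \<xi> s) \<le> M" if "0 \<le> s" for s
      using speed[OF inX[OF \<xi> that]] .
    show "(\<xi> has_vector_derivative A (\<xi> s) *v \<xi> s) (at s within {0..})" if "0 \<le> s" for s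
      using deriv[OF \<xi>(1) that] .
  qed (use that in auto)
  have "N (\<xi> t) \<le> K * exp (t * (sqrt (K * L * M * ln 2) - \<omega>)) * N x0" if "0 < t" for t
    using bound[OF that] unfolding eq \<xi>(2) .
  then show ?thesis
    using \<xi> unique by (intro exI[of _ \<xi>]) blast
qed

end
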